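(* Let $E$ be a finite set (the edge set of a finite directed graph), let $\lambda=(s_1,\dots,s_q)$ be a multiset of positive integers with $s_1+\cdots+s_q=|E|$, and let $m_r$ be the number of indices $i$ with $s_i=r$. Then $$|\mathcal P_\lambda(E)|=\frac{|E|!}{\prod_{i=1}^{q}s_i!\,\prod_{r\ge1}m_r!}.$$
   Context: An edge partition is an unlabelled collection $\Pi=\{C_1,\dots,C_q\}$ of nonempty pairwise disjoint subsets of $E$ whose union is $E$. Its profile $\lambda(\Pi)$ is the multiset of block sizes $|C_1|,\dots,|C_q|$. The profile fibre $\mathcal P_\lambda(E)$ is the set of edge partitions $\Pi$ with $\lambda(\Pi)=\lambda$. *)

theory Defs
  imports Complex_Main "HOL-Library.Multiset" "HOL-Library.Disjoint_Sets"
begin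

text \<open>
  Edge partitions of \<open>E\<close> are the sets \<open>P\<close> of blocks with \<^term>\<open>partition_on E P\<close>.
  Since \<^const>\<open>mset_set\<close> sends infinite sets to the empty multiset, \<open>profile\<close> is only meaningful
  for finite \<open>P\<close>; every partition of a finite set is finite.
\<close>

definition profile :: "'e set set \<Rightarrow> nat multiset" where
  "profile P = image_mset card (mset_set P)"

definition profile_fibre :: "nat multiset \<Rightarrow> 'e set \<Rightarrow> 'e set set set" where
  "profile_fibre L E = {P. partition_on E P \<and> profile P = L}"

end

(*
  Count pairs (P, C) of a partition P with profile L + {s} and a block C of P of size s.  Each P has
  exactly m_s such blocks, and deleting C leaves a partition of E - C with profile L, so the fibre
  cardinality for L + {s} times m_s equals the sum, over the s-subsets C of E, of the fibre
  cardinalities for L on E - C.  The formula follows by induction on L.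
*)
theory Submission
  imports Defs
begin

lemma finite_profile_fibre:
  assumes "finite E"
  shows "finite (profile_fibre L E)"
  using finitely_many_partition_on[OF assms] by (simp add: profile_fibre_def)

lemma profile_insert:
  assumes "finite P" "C \<notin> P"
  shows "profile (insert C P) = add_mset (card C) (profile P)"
  using assms by (simp add: profile_def)

lemma card_blocks_of_size:
  assumes "finite P"
  shows "card {C \<in> P. card C = s} = count (profile P) s"
proof -
  have "card -` {s} \<inter> P = {C \<in> P. card C = s}"
    by auto
  then show ?thesis
    using assms by (simp add: profile_def count_image_mset)
qed

lemma partition_on_Diff_block:
  assumes "partition_on E P" "C \<in> P"
  shows "partition_on (E - C) (P - {C})"
proof -
  have "disjnt C (\<Union> (P - {C}))"
    using assms by (auto simp: partition_on_def disjoint_def disjnt_def)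
  \<comment> \<open>The rule is an equivalence, used here from left to right;
    \<open>insert C (P - {C})\<close> collapses to \<open>P\<close> because \<open>C\<close> is a
    block.\<close>
  from partition_on_insert[OF this, of E] show ?thesis
    using assms by (simp add: insert_absorb)
qed

text \<open>If \<open>C\<close> were already in \<open>Q\<close>, it would lie inside
  \<open>E - C\<close> and so be empty.\<close>

lemma partition_on_insert_block:
  assumes "partition_on (E - C) Q" "C \<subseteq> E" "C \<noteq> {}"
  shows "partition_on E (insert C Q)" "C \<notin> Q"
proof -
  have U: "\<Union> Q = E - C"
    using assms(1) by (simp add: partition_on_def)
  then have "disjnt C (\<Union> Q)"
    by (simp add: disjnt_def)
  from partition_on_insert[OF this, of E] show "partition_on E (insert C Q)"
    using assms by simp
  show "C \<notin> Q"
    using U assms(3) by blast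
qed

text \<open>The factor \<open>Suc (count L s)\<close> is the multiplicity of \<open>s\<close> in
  \<open>add_mset s L\<close>, i.e. the number of choices of a marked block. Positivity of
  \<open>s\<close> makes every \<open>s\<close>-subset nonempty, hence admissible as a
  block.\<close>

lemma card_profile_fibre_add_mset:
  assumes "finite E" "s > 0"
  shows "card (profile_fibre (add_mset s L) E) * Suc (count L s) =
    (\<Sum>C | C \<subseteq> E \<and> card C = s. card (profile_fibre L (E - C)))"
proof -
  let ?F = "profile_fibre (add_mset s L) E"
  let ?A = "SIGMA P : ?F. {C \<in> P. card C = s}"
  let ?B = "SIGMA C : {C. C \<subseteq> E \<and> card C = s}. profile_fibre L (E - C)"
  have finP: "finite P" if "partition_on E P" for P
    using finite_elements[OF \<open>finite E\<close> that] .
  have "card ?F * Suc (count L s) = (\<Sum>P\<in>?F. card {C \<in> P. card C = s})"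
    by (simp add: card_blocks_of_size finP profile_fibre_def)
  also have "\<dots> = card ?A"
  proof (rule card_SigmaI[symmetric])
    show "\<forall>P\<in>?F. finite {C \<in> P. card C = s}"
      using finP by (simp add: profile_fibre_def)
  qed (rule finite_profile_fibre[OF \<open>finite E\<close>])
  also have "\<dots> = card ?B"
  proof (rule bij_betw_same_card[OF bij_betw_byWitness])
    \<comment> \<open>\<open>?f\<close> detaches the marked block and \<open>?g\<close> puts it
      back. That \<open>?g\<close> is undone by \<open>?f\<close> relies on
      \<open>C \<notin> Q\<close>.\<close>
    let ?f = "\<lambda>(P, C). (C, P - {C})" and ?g = "\<lambda>(C, Q). (insert C Q, C)"
    show "\<forall>a\<in>?A. ?g (?f a) = a"
      by auto
    have B: "partition_on E (insert C Q)" "C \<notin> Q" "profile (insert C Q) = add_mset s L"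
      if "(C, Q) \<in> ?B" for C Q
    proof -
      have C: "C \<subseteq> E" "C \<noteq> {}" "card C = s"
        and Q: "partition_on (E - C) Q" "profile Q = L"
        using that \<open>s > 0\<close> by (auto simp: profile_fibre_def)
      show "partition_on E (insert C Q)" "C \<notin> Q"
        using partition_on_insert_block[OF Q(1) C(1,2)] by auto
      then show "profile (insert C Q) = add_mset s L"
        using finP[of "insert C Q"] C Q by (simp add: profile_insert)
    qed
    then show "\<forall>b\<in>?B. ?f (?g b) = b"
      by auto
    show "?g ` ?B \<subseteq> ?A"
      using B by (force simp: profile_fibre_def)
    have "(C, P - {C}) \<in> ?B" if "P \<in> ?F" and C: "C \<in> P" "card C = s" for P C
    proof -
      have P: "partition_on E P" "profile P = add_mset s L"
        using that(1) by (auto simp: profile_fibre_def)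
      have "profile (insert C (P - {C})) = add_mset (card C) (profile (P - {C}))"
        using finP[OF P(1)] by (intro profile_insert) auto
      then have "profile (P - {C}) = L"
        using P(2) C by (simp add: insert_absorb)
      then show ?thesis
        using partition_on_Diff_block[OF P(1) C(1)] partition_onD1[OF P(1)] C
        by (auto simp: profile_fibre_def)
    qed
    then show "?f ` ?A \<subseteq> ?B"
      by auto
  qed
  also have "\<dots> = (\<Sum>C | C \<subseteq> E \<and> card C = s. card (profile_fibre L (E - C)))"
    by (subst card_SigmaI) (use \<open>finite E\<close> in \<open>auto simp: finite_profile_fibre\<close>)
  finally show ?thesis .
qed

text \<open>Only the factor at \<open>r = s\<close> changes, growing by
  \<open>Suc (count L s)\<close>; it occurs in the product since \<open>s \<in> R\<close>.\<close>

lemma prod_fact_count_add_mset: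
  assumes "finite R" "s \<in> R"
  shows "(\<Prod>r\<in>R. fact (count (add_mset s L) r) :: nat) =
    Suc (count L s) * (\<Prod>r\<in>R. fact (count L r))"
proof -
  have "(\<Prod>r\<in>R. fact (count (add_mset s L) r) :: nat) =
      (\<Prod>r\<in>R. (if r = s then Suc (count L s) else 1) * fact (count L r))"
    by (intro prod.cong) auto
  also have "\<dots> = Suc (count L s) * (\<Prod>r\<in>R. fact (count L r))"
    using assms by (simp add: prod.distrib prod.delta)
  finally show ?thesis .
qed

text \<open>The formula is cleared of denominators to stay in the naturals. The index set
  \<open>R\<close> is fixed throughout the induction, whereas \<open>{1..card E}\<close> would
  shrink with \<open>E\<close>.\<close>

lemma card_profile_fibre_mult:
  fixes E :: "'e set"
  assumes "finite R" "set_mset L \<subseteq> R" "0 \<notin># L" "finite E" "sum_mset L = card E"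
  shows "card (profile_fibre L E) * ((\<Prod>s\<in>#L. fact s) * (\<Prod>r\<in>R. fact (count L r))) =
    fact (card E)"
  using assms(2-)
proof (induction L arbitrary: E)
  case empty
  then have "profile_fibre {#} E = {{}}"
    by (auto simp: profile_fibre_def partition_on_empty profile_def)
  then show ?case
    using empty by simp
next
  case (add s L)
  let ?D = "\<lambda>L. (\<Prod>s\<in>#L. fact s) * (\<Prod>r\<in>R. fact (count L r)) :: nat"
  have s: "s > 0" "s \<in> R" "s \<le> card E"
    using add.prems by auto
  have IH: "card (profile_fibre L (E - C)) * ?D L = fact (card E - s)"
    if "C \<subseteq> E" "card C = s" for C
  proof -
    have "card (E - C) = card E - s"
      using that add.prems(3) by (simp add: card_Diff_subset finite_subset)
    then show ?thesis
      using add.IH[of "E - C"] add.prems by auto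
  qed
  \<comment> \<open>The new denominator contributes \<open>fact s\<close> and
    \<open>Suc (count L s)\<close>; the latter is exactly what the double count absorbs.\<close>
  have "card (profile_fibre (add_mset s L) E) * ?D (add_mset s L) =
      fact s * ((card (profile_fibre (add_mset s L) E) * Suc (count L s)) * ?D L)"
    by (simp only: prod_fact_count_add_mset[OF \<open>finite R\<close> s(2)] image_mset_add_mset
        prod_mset.add_mset mult_ac)
  also have "\<dots> = fact s * (\<Sum>C | C \<subseteq> E \<and> card C = s. card (profile_fibre L (E - C)) * ?D L)"
    by (simp only: card_profile_fibre_add_mset[OF add.prems(3) s(1)] sum_distrib_right)
  also have "\<dots> = fact s * (\<Sum>C | C \<subseteq> E \<and> card C = s. fact (card E - s))"
    using IH by (intro arg_cong[of _ _ "(*) (fact s)"] sum.cong) auto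
  also have "\<dots> = fact s * fact (card E - s) * (card E choose s)"
    using n_subsets[OF add.prems(3), of s] by simp
  also have "\<dots> = fact (card E)"
    using binomial_fact_lemma[OF s(3)] .
  finally show ?case .
qed

theorem mainTheorem6:
  fixes E :: "'e set" and L :: "nat multiset"
  assumes "finite E"
    and "\<forall>s\<in>#L. s > 0"
    and "sum_mset L = card E"
  shows "real (card (profile_fibre L E)) =
    fact (card E) / ((\<Prod>s\<in>#L. fact s) * (\<Prod>r\<in>{1..card E}. fact (count L r)))"
proof -
  \<comment> \<open>Each size is positive and bounded by the total, so multiplicities vanish outside
    this range and the product over all \<open>r \<ge> 1\<close> may stop at
    \<open>card E\<close>.\<close>
  have "set_mset L \<subseteq> {1..card E}"
    using assms(2,3) by (auto simp: Suc_le_eq dest!: multi_member_split)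
  then have "card (profile_fibre L E) *
      ((\<Prod>s\<in>#L. fact s) * (\<Prod>r\<in>{1..card E}. fact (count L r))) = fact (card E)"
    using assms by (intro card_profile_fibre_mult) auto
  from arg_cong[OF this, of real]
  have "real (card (profile_fibre L E)) *
      (real (\<Prod>s\<in>#L. fact s) * (\<Prod>r\<in>{1..card E}. fact (count L r))) = fact (card E)"
    by simp
  \<comment> \<open>Moving the cast inside the multiset product and showing that product nonzero
    permits the division.\<close>
  moreover have "real (\<Prod>s\<in>#M. fact s) = (\<Prod>s\<in>#M. fact s)" for M
    by (induction M) auto
  moreover have "(\<Prod>s\<in>#M. fact s :: real) \<noteq> 0" for M
    by (induction M) auto
  ultimately show ?thesis
    by (simp add: eq_divide_eq)
qed

end
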